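(* Let $$F(z)=\operatorname{Re}\left(\frac{z}{(1-z)^2}\right)+i\operatorname{Im}\left(\frac{z}{1-z}\right)=\frac12\left(\frac{z}{1-z}+\frac{z}{(1-z)^2}\right)+\overline{\frac12\left(\frac{z}{(1-z)^2}-\frac{z}{1-z}\right)},\qquad z\in\mathbb{D}.$$ Let $f=h+\overline{g}\in\mathcal{K}_H^0$ with $h(z)+g(z)=z/(1-z)$ and dilatation $w(z)=g'(z)/h'(z)=e^{i\theta}z^n$, where $\theta\in\mathbb{R}$. If $n=1$ or $n=2$, then the harmonic convolution $F*f$ is locally univalent in $\mathbb{D}$.
   Context: $\mathbb{D}=\{z\in\mathbb{C}:|z|<1\}$. $\mathcal{K}_H^0$ is the class of complex-valued harmonic functions $f=h+\overline{g}$ in $\mathbb{D}$ ($h$, $g$ analytic, $h(z)=z+\sum_{n\ge2}a_nz^n$, $g(z)=\sum_{n\ge1}b_nz^n$) that are univalent and sense-preserving in $\mathbb{D}$, satisfy $f_{\bar z}(0)=0$, and map $\mathbb{D}$ onto a convex domain. Harmonic convolution: for $f=z+\sum_{n\ge2}a_nz^n+\overline{\sum_{n\ge1}b_nz^n}$ and $F=z+\sum_{n\ge2}A_nz^n+\overline{\sum_{n\ge1}B_nz^n}$, $F*f=z+\sum_{n\ge2}a_nA_nz^n+\overline{\sum_{n\ge1}b_nB_nz^n}$. *)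

theory Defs
  imports "HOL-Complex_Analysis.Complex_Analysis"
begin

text \<open>Wirtinger derivatives $f_z = (f_x - i f_y)/2$ and $f_{\bar z} = (f_x + i f_y)/2$, where
  $f_x$ and $f_y$ are the values of the real derivative in the directions $1$ and $i$.\<close>

definition wirtinger :: "(complex \<Rightarrow> complex) \<Rightarrow> complex \<Rightarrow> complex" where
  "wirtinger f z =
     (frechet_derivative f (at z) 1 - \<i> * frechet_derivative f (at z) \<i>) / 2"

definition wirtinger_bar :: "(complex \<Rightarrow> complex) \<Rightarrow> complex \<Rightarrow> complex" where
  "wirtinger_bar f z =
     (frechet_derivative f (at z) 1 + \<i> * frechet_derivative f (at z) \<i>) / 2"

text \<open>Sense-preserving means positive Jacobian $|f_z|^2 - |f_{\bar z}|^2$.\<close>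

definition sense_preserving_on :: "(complex \<Rightarrow> complex) \<Rightarrow> complex set \<Rightarrow> bool" where
  "sense_preserving_on f S \<longleftrightarrow>
     (\<forall>z\<in>S. (cmod (wirtinger f z))\<^sup>2 - (cmod (wirtinger_bar f z))\<^sup>2 > 0)"

definition locally_univalent_on :: "(complex \<Rightarrow> complex) \<Rightarrow> complex set \<Rightarrow> bool" where
  "locally_univalent_on f S \<longleftrightarrow>
     (\<forall>z\<in>S. \<exists>U. open U \<and> z \<in> U \<and> U \<subseteq> S \<and> inj_on f U)"

text \<open>$f = h + \overline{g}$ on the unit disc, where
  $h(z) = z + \sum_{n\ge 2} a_n z^n$ and $g(z) = \sum_{n\ge 1} b_n z^n$ are analytic.\<close>

definition canonical_decomp ::
  "(complex \<Rightarrow> complex) \<Rightarrow> (complex \<Rightarrow> complex) \<Rightarrow> (complex \<Rightarrow> complex) \<Rightarrow> bool" where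
  "canonical_decomp f h g \<longleftrightarrow>
     h holomorphic_on ball 0 1 \<and> g holomorphic_on ball 0 1 \<and>
     h 0 = 0 \<and> deriv h 0 = 1 \<and> g 0 = 0 \<and>
     (\<forall>z\<in>ball 0 1. f z = h z + cnj (g z))"

text \<open>Membership only depends on the values of \<open>f\<close> on the unit disc.\<close>

definition K_H0 :: "(complex \<Rightarrow> complex) set" where
  "K_H0 = {f. (\<exists>h g. canonical_decomp f h g) \<and>
              inj_on f (ball 0 1) \<and>
              sense_preserving_on f (ball 0 1) \<and>
              wirtinger_bar f 0 = 0 \<and>
              open (f ` ball 0 1) \<and> convex (f ` ball 0 1)}"

text \<open>The expansion $f(z) = z + \sum_{n\ge 2} a_n z^n + \overline{\sum_{n\ge 1} b_n z^n}$ on the unit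
  disc; the conditions on \<open>a 0\<close>, \<open>a 1\<close>, \<open>b 0\<close> allow all series to start at index \<open>0\<close>.\<close>

definition harmonic_series ::
  "(complex \<Rightarrow> complex) \<Rightarrow> (nat \<Rightarrow> complex) \<Rightarrow> (nat \<Rightarrow> complex) \<Rightarrow> bool" where
  "harmonic_series f a b \<longleftrightarrow>
     a 0 = 0 \<and> a 1 = 1 \<and> b 0 = 0 \<and>
     (\<forall>z\<in>ball 0 1. summable (\<lambda>n. a n * z ^ n) \<and> summable (\<lambda>n. b n * z ^ n) \<and>
        f z = (\<Sum>n. a n * z ^ n) + cnj (\<Sum>n. b n * z ^ n))"

lemma harmonic_series_unique:
  assumes "harmonic_series f a b" and "harmonic_series f a' b'"
  shows "a = a' \<and> b = b'"
proof -
  have main: "c = (\<lambda>n. 0)"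
    if sc: "\<And>z. z \<in> ball 0 1 \<Longrightarrow> summable (\<lambda>n. c n * z ^ n)"
      and sd: "\<And>z. z \<in> ball 0 1 \<Longrightarrow> summable (\<lambda>n. d n * z ^ n)"
      and eq: "\<And>z. z \<in> ball 0 1 \<Longrightarrow> (\<Sum>n. c n * z ^ n) = cnj (\<Sum>n. d n * z ^ n)"
      and c0: "c 0 = 0"
    for c d :: "nat \<Rightarrow> complex"
  proof -
    define p where "p z = (\<Sum>n. c n * z ^ n)" for z
    define q where "q z = (\<Sum>n. d n * z ^ n)" for z
    have sums: "(\<lambda>n. c n * z ^ n) sums p z" "(\<lambda>n. d n * z ^ n) sums q z"
      if "z \<in> ball 0 1" for z
      using sc[OF that] sd[OF that] by (simp_all add: p_def q_def summable_sums)
    have hol: "p holomorphic_on ball 0 1" "q holomorphic_on ball 0 1"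
      by (rule power_series_holomorphic[where a = c], use sums in simp)
         (rule power_series_holomorphic[where a = d], use sums in simp)
    have pq: "p z = cnj (q z)" if "z \<in> ball 0 1" for z
      using eq[OF that] by (simp add: p_def q_def)
    have dp: "deriv p z = 0" if z: "z \<in> ball 0 1" for z
    proof -
      have "(p has_field_derivative deriv p z) (at z)"
        "(q has_field_derivative deriv q z) (at z)"
        using hol z by (auto intro: holomorphic_derivI)
      then have 1: "(p has_derivative (\<lambda>t. deriv p z * t)) (at z)"
        and 2: "(q has_derivative (\<lambda>t. deriv q z * t)) (at z)"
        by (simp_all add: has_field_derivative_def)
      have "((\<lambda>z. cnj (q z)) has_derivative (\<lambda>t. cnj (deriv q z * t))) (at z)"
        by (rule has_derivative_cnj[OF 2])
      then have "(p has_derivative (\<lambda>t. cnj (deriv q z * t))) (at z)"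
        by (rule has_derivative_transform_within_open[of _ _ _ _ "ball 0 1"])
           (use z pq in auto)
      then have E: "(\<lambda>t. deriv p z * t) = (\<lambda>t. cnj (deriv q z * t))"
        using 1 has_derivative_unique by blast
      show ?thesis
        using fun_cong[OF E, of 1] fun_cong[OF E, of \<i>] by (simp add: complex_eq_iff)
    qed
    have "p constant_on ball 0 1"
      by (rule has_field_derivative_0_imp_constant_on)
         (use holomorphic_derivI[OF hol(1)] dp in fastforce)+
    moreover have "p 0 = 0"
      using c0 by (simp add: p_def)
    ultimately have p0: "p z = 0" if "z \<in> ball 0 1" for z
      using that unfolding constant_on_def by (metis centre_in_ball zero_less_one)
    show ?thesis
    proof (rule ccontr)
      assume "c \<noteq> (\<lambda>n. 0)"
      then obtain m where m: "c m \<noteq> 0" by auto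
      have "m > 0" using m c0 by (cases m) auto
      obtain s where s: "0 < s" "\<And>z. z \<in> cball 0 s - {0} \<Longrightarrow> p z \<noteq> 0"
        by (rule powser_0_nonzero[of 1 0 c p m])
           (use sums p0 m \<open>m > 0\<close> in \<open>auto simp: dist_norm\<close>)
      define x where "x = complex_of_real (min s (1/2))"
      have "x \<in> cball 0 s - {0}" "x \<in> ball 0 1"
        using s(1) by (auto simp: x_def)
      then show False using s(2) p0 by blast
    qed
  qed
  note A = assms[unfolded harmonic_series_def]
  have S: "(\<Sum>n. (a n - a' n) * z ^ n) = (\<Sum>n. a n * z ^ n) - (\<Sum>n. a' n * z ^ n)"
    "(\<Sum>n. (b' n - b n) * z ^ n) = (\<Sum>n. b' n * z ^ n) - (\<Sum>n. b n * z ^ n)"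
    "summable (\<lambda>n. (a n - a' n) * z ^ n)" "summable (\<lambda>n. (b' n - b n) * z ^ n)"
    if "z \<in> ball 0 1" for z
    using A that by (simp_all add: algebra_simps suminf_diff summable_diff)
  have E: "(\<Sum>n. (a n - a' n) * z ^ n) = cnj (\<Sum>n. (b' n - b n) * z ^ n)"
    if z: "z \<in> ball 0 1" for z
  proof -
    have "(\<Sum>n. a n * z ^ n) + cnj (\<Sum>n. b n * z ^ n) =
          (\<Sum>n. a' n * z ^ n) + cnj (\<Sum>n. b' n * z ^ n)"
      using A z by metis
    then show ?thesis
      unfolding S[OF z] by (simp add: algebra_simps)
  qed
  have "(\<lambda>n. a n - a' n) = (\<lambda>n. 0)"
    by (rule main[of _ "\<lambda>n. b' n - b n"]) (use S E A in auto)
  moreover have "(\<lambda>n. b' n - b n) = (\<lambda>n. 0)"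
  proof (rule main[of _ "\<lambda>n. a n - a' n"])
    show "(\<Sum>n. (b' n - b n) * z ^ n) = cnj (\<Sum>n. (a n - a' n) * z ^ n)"
      if "z \<in> ball 0 1" for z
      unfolding E[OF that] by simp
  qed (use S A in auto)
  ultimately show ?thesis
    by (auto simp: fun_eq_iff)
qed

lemma canonical_decomp_imp_harmonic_series:
  assumes "canonical_decomp f h g"
  shows "harmonic_series f (\<lambda>n. (deriv ^^ n) h 0 / fact n) (\<lambda>n. (deriv ^^ n) g 0 / fact n)"
proof -
  note A = assms[unfolded canonical_decomp_def]
  have "(\<lambda>n. (deriv ^^ n) h 0 / fact n * z ^ n) sums h z"
    "(\<lambda>n. (deriv ^^ n) g 0 / fact n * z ^ n) sums g z" if "z \<in> ball 0 1" for z
    using A that holomorphic_power_series[of h 0 1 z] holomorphic_power_series[of g 0 1 z] by simp_all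
  then show ?thesis
    using A unfolding harmonic_series_def
    by (auto simp: sums_iff)
qed

definition harmonic_coeffs ::
  "(complex \<Rightarrow> complex) \<Rightarrow> (nat \<Rightarrow> complex) \<times> (nat \<Rightarrow> complex)" where
  "harmonic_coeffs f = (THE (a, b). harmonic_series f a b)"

lemma harmonic_coeffs_eq:
  assumes "harmonic_series f a b"
  shows "harmonic_coeffs f = (a, b)"
  unfolding harmonic_coeffs_def
  by (rule the_equality) (use assms harmonic_series_unique in blast)+

definition harmonic_conv ::
  "(complex \<Rightarrow> complex) \<Rightarrow> (complex \<Rightarrow> complex) \<Rightarrow> complex \<Rightarrow> complex" where
  "harmonic_conv F f =
     (let (A, B) = harmonic_coeffs F; (a, b) = harmonic_coeffs f
      in (\<lambda>z. (\<Sum>n. a n * A n * z ^ n) + cnj (\<Sum>n. b n * B n * z ^ n)))"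

lemma harmonic_conv_eq:
  assumes "harmonic_series F A B" and "harmonic_series f a b"
  shows "harmonic_conv F f z = (\<Sum>n. a n * A n * z ^ n) + cnj (\<Sum>n. b n * B n * z ^ n)"
  by (simp add: harmonic_conv_def harmonic_coeffs_eq[OF assms(1)] harmonic_coeffs_eq[OF assms(2)])

definition conv_F :: "complex \<Rightarrow> complex" where
  "conv_F z = of_real (Re (z / (1 - z)\<^sup>2)) + \<i> * of_real (Im (z / (1 - z)))"

lemma conv_F_eq:
  "conv_F z = (z / (1 - z) + z / (1 - z)\<^sup>2) / 2 + cnj ((z / (1 - z)\<^sup>2 - z / (1 - z)) / 2)"
proof -
  have "of_real (Re u) + \<i> * of_real (Im v) = (v + u) / 2 + cnj ((u - v) / 2)" for u v :: complex
    by (simp add: complex_eq_iff field_simps)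
  then show ?thesis
    unfolding conv_F_def by blast
qed

end

theory Submission
  imports Defs
begin

text \<open>
  The coefficients of \<open>F\<close> are \<open>(n + 1) / 2\<close> and \<open>(n - 1) / 2\<close>, so convolving with \<open>F\<close> acts as a
  first-order differential operator: \<open>F * f = H + cnj G\<close> with \<open>2 H = h + z h'\<close> and
  \<open>2 G = z g' - g\<close>. By the inverse function theorem for harmonic maps it suffices that
  \<open>|G'| < |H'|\<close> throughout the disc.

  The two relations \<open>h' + g' = 1 / (1 - z)\<^sup>2\<close> and \<open>g' = w h'\<close> express \<open>h'\<close>, \<open>h''\<close>, \<open>g''\<close> through
  \<open>w\<close> and \<open>w'\<close>, and up to one common nonvanishing factor
  \<open>H'\<close> is \<open>D = 2 (1 + w) - z w' (1 - z)\<close> and \<open>G'\<close> is \<open>N = z (w' (1 - z) + 2 w (1 + w))\<close>.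
  For \<open>w = c z\<^sup>n\<close> with \<open>|c| = 1\<close>:

  \<^item> If \<open>n = 2\<close>, then \<open>N = w D\<close> and \<open>D = 2 (1 + c z\<^sup>3)\<close>, so the dilatation is unchanged.

  \<^item> If \<open>n = 1\<close>, then \<open>N = w (1 + z + 2 c z\<^sup>2)\<close> and \<open>D = 2 + c z + c z\<^sup>2\<close> is, up to the factor \<open>c\<close>,
    the reciprocal polynomial of \<open>1 + z + 2 c z\<^sup>2\<close>. Hence \<open>|D|\<^sup>2 - |1 + z + 2 c z\<^sup>2|\<^sup>2\<close> is divisible by
    \<open>1 - |z|\<^sup>2\<close>, and the quotient \<open>3 + 2 Re ((2 c - 1) z) + 3 |z|\<^sup>2\<close> is positive in the disc because
    \<open>|2 c - 1| \<le> 3\<close>.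
\<close>

text \<open>On a small disc \<open>H\<close> and \<open>G\<close> differ from their linear parts at the centre \<open>z\<close> by
  \<open>e\<close>-Lipschitz functions. With \<open>2 e < |H' z| - |G' z|\<close> these errors cannot compensate the
  lower bound \<open>|H' z| - |G' z|\<close> for the linear part of \<open>H + cnj G\<close>.\<close>

lemma harmonic_locally_univalent_on:
  assumes S: "open S" and hol: "H holomorphic_on S" "G holomorphic_on S"
    and less: "\<And>z. z \<in> S \<Longrightarrow> cmod (deriv G z) < cmod (deriv H z)"
    and f: "\<And>z. z \<in> S \<Longrightarrow> f z = H z + cnj (G z)"
  shows "locally_univalent_on f S"
  unfolding locally_univalent_on_def
proof
  fix z assume z: "z \<in> S"
  define e where "e = (cmod (deriv H z) - cmod (deriv G z)) / 3"
  have e: "e > 0" using less[OF z] by (simp add: e_def)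
  have linear_approx: "\<exists>d>0. ball z d \<subseteq> S \<and>
      (\<forall>x\<in>ball z d. \<forall>y\<in>ball z d. cmod (K x - K y - deriv K z * (x - y)) \<le> e * cmod (x - y))"
    if K: "K holomorphic_on S" for K
  proof -
    have "isCont (deriv K) z"
      using holomorphic_deriv[OF K S] S z holomorphic_on_imp_continuous_on continuous_on_eq_continuous_at by blast
    then obtain d1 where d1: "d1 > 0" "\<And>x. dist x z < d1 \<Longrightarrow> dist (deriv K x) (deriv K z) < e"
      using e unfolding continuous_at_eps_delta by blast
    obtain d2 where d2: "d2 > 0" "ball z d2 \<subseteq> S"
      using S z openE by blast
    let ?d = "min d1 d2"
    have "cmod ((K x - deriv K z * x) - (K y - deriv K z * y)) \<le> e * cmod (x - y)"
      if "x \<in> ball z ?d" "y \<in> ball z ?d" for x y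
    proof (rule field_differentiable_bound[where S = "ball z ?d"])
      fix u assume u: "u \<in> ball z ?d"
      then have "u \<in> S" using d2 by auto
      then have "(K has_field_derivative deriv K u) (at u within ball z ?d)"
        using holomorphic_derivI[OF K S] has_field_derivative_at_within by blast
      then show "((\<lambda>x. K x - deriv K z * x) has_field_derivative deriv K u - deriv K z)
          (at u within ball z ?d)"
        by (auto intro!: derivative_eq_intros)
      show "cmod (deriv K u - deriv K z) \<le> e"
        using d1(2)[of u] u by (auto simp: dist_norm norm_minus_commute)
    qed (use that in auto)
    then show ?thesis
      using d1 d2 by (intro exI[of _ ?d]) (auto simp: algebra_simps)
  qed
  obtain d1 where d1: "d1 > 0" "ball z d1 \<subseteq> S"
    "\<And>x y. x \<in> ball z d1 \<Longrightarrow> y \<in> ball z d1 \<Longrightarrow>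
       cmod (H x - H y - deriv H z * (x - y)) \<le> e * cmod (x - y)"
    using linear_approx[OF hol(1)] by blast
  obtain d2 where d2: "d2 > 0" "ball z d2 \<subseteq> S"
    "\<And>x y. x \<in> ball z d2 \<Longrightarrow> y \<in> ball z d2 \<Longrightarrow>
       cmod (G x - G y - deriv G z * (x - y)) \<le> e * cmod (x - y)"
    using linear_approx[OF hol(2)] by blast
  have "inj_on f (ball z (min d1 d2))"
  proof (rule inj_onI)
    fix x y assume xy: "x \<in> ball z (min d1 d2)" "y \<in> ball z (min d1 d2)" and eq: "f x = f y"
    have "x \<in> S" "y \<in> S"
      using xy d1(2) by auto
    then have "H x + cnj (G x) = H y + cnj (G y)"
      using eq f by metis
    then have "H x - H y = cnj (G y - G x)"
      by (simp add: algebra_simps)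
    then have same: "cmod (H x - H y) = cmod (G x - G y)"
      by (metis complex_mod_cnj norm_minus_commute)
    have "cmod (deriv H z) * cmod (x - y) \<le> cmod (H x - H y) + e * cmod (x - y)"
      using d1(3)[of x y] xy norm_triangle_ineq2[of "deriv H z * (x - y)" "H x - H y"]
      by (simp add: norm_mult norm_minus_commute)
    moreover have "cmod (G x - G y) \<le> cmod (deriv G z) * cmod (x - y) + e * cmod (x - y)"
      using d2(3)[of x y] xy norm_triangle_ineq2[of "G x - G y" "deriv G z * (x - y)"]
      by (simp add: norm_mult)
    ultimately have "(cmod (deriv H z) - cmod (deriv G z) - 2 * e) * cmod (x - y) \<le> 0"
      using same by (simp add: algebra_simps)
    then have "e * cmod (x - y) \<le> 0"
      by (simp add: e_def field_simps)
    then show "x = y"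
      using e by (simp add: mult_le_0_iff)
  qed
  then show "\<exists>U. open U \<and> z \<in> U \<and> U \<subseteq> S \<and> inj_on f U"
    using d1 d2 by (intro exI[of _ "ball z (min d1 d2)"]) auto
qed

lemma harmonic_series_conv_F:
  "harmonic_series conv_F (\<lambda>n. if n = 0 then 0 else (of_nat n + 1) / 2)
     (\<lambda>n. if n = 0 then 0 else (of_nat n - 1) / 2)"
proof -
  have "(\<lambda>n. (if n = 0 then 0 else (of_nat n + 1) / 2) * z ^ n) sums
          ((z / (1 - z) + z / (1 - z)\<^sup>2) / 2)"
    "(\<lambda>n. (if n = 0 then 0 else (of_nat n - 1) / 2) * z ^ n) sums
          ((z / (1 - z)\<^sup>2 - z / (1 - z)) / 2)"
    if "z \<in> ball 0 1" for z :: complex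
  proof -
    have z: "cmod z < 1" using that by simp
    have id: "(\<lambda>n. z * z ^ n) sums (z * (1 / (1 - z)))"
      by (rule sums_mult[OF geometric_sums[OF z]])
    have koebe: "(\<lambda>n. z * (of_nat (Suc n) * z ^ n)) sums (z * (1 / (1 - z)\<^sup>2))"
      by (rule sums_mult[OF geometric_deriv_sums[OF z]])
    have "(\<lambda>n. (of_nat (Suc n) + 1) / 2 * z ^ Suc n) sums ((z / (1 - z) + z / (1 - z)\<^sup>2) / 2)"
      using sums_divide[OF sums_add[OF id koebe], of 2]
      by (simp add: algebra_simps add_divide_distrib)
    then show "(\<lambda>n. (if n = 0 then 0 else (of_nat n + 1) / 2) * z ^ n) sums ((z / (1 - z) + z / (1 - z)\<^sup>2) / 2)"
      using sums_Suc_iff[of "\<lambda>n. (if n = 0 then 0 else (of_nat n + 1) / 2) * z ^ n"]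
      by simp
    have "(\<lambda>n. (of_nat (Suc n) - 1) / 2 * z ^ Suc n) sums ((z / (1 - z)\<^sup>2 - z / (1 - z)) / 2)"
      using sums_divide[OF sums_diff[OF koebe id], of 2]
      by (simp add: algebra_simps add_divide_distrib)
    then show "(\<lambda>n. (if n = 0 then 0 else (of_nat n - 1) / 2) * z ^ n) sums ((z / (1 - z)\<^sup>2 - z / (1 - z)) / 2)"
      using sums_Suc_iff[of "\<lambda>n. (if n = 0 then 0 else (of_nat n - 1) / 2) * z ^ n"]
      by simp
  qed
  note sums = this[unfolded sums_iff]
  show ?thesis
    unfolding harmonic_series_def conv_F_eq
  proof (intro conjI ballI)
    fix z :: complex assume z: "z \<in> ball 0 1"
    show "(z / (1 - z) + z / (1 - z)\<^sup>2) / 2 + cnj ((z / (1 - z)\<^sup>2 - z / (1 - z)) / 2)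
      = (\<Sum>n. (if n = 0 then 0 else (of_nat n + 1) / 2) * z ^ n)
        + cnj (\<Sum>n. (if n = 0 then 0 else (of_nat n - 1) / 2) * z ^ n)"
      using sums[OF z] by metis
  qed (use sums in auto)
qed

lemma euler_operator_power_series:
  assumes "h holomorphic_on ball 0 1" and z: "z \<in> ball 0 1"
  shows "(\<lambda>n. of_nat n * ((deriv ^^ n) h 0 / fact n) * z ^ n) sums (z * deriv h z)"
proof -
  have "deriv h holomorphic_on ball 0 1"
    using assms by (simp add: holomorphic_deriv)
  then have "(\<lambda>n. (deriv ^^ n) (deriv h) 0 / fact n * z ^ n) sums deriv h z"
    using holomorphic_power_series[of "deriv h" 0 1 z] z by simp
  from sums_mult[OF this, of z]
  have "(\<lambda>n. of_nat (Suc n) * ((deriv ^^ Suc n) h 0 / fact (Suc n)) * z ^ Suc n) sums (z * deriv h z)"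
    by (simp add: funpow_swap1 mult_ac del: of_nat_Suc)
  then show ?thesis
    using sums_Suc_iff[of "\<lambda>n. of_nat n * ((deriv ^^ n) h 0 / fact n) * z ^ n"] by simp
qed

text \<open>Multiplying the \<open>n\<close>-th coefficient by \<open>n\<close> is the operator \<open>z d/dz\<close>; this turns the
  convolution into a differential expression in \<open>h\<close> and \<open>g\<close>.\<close>

lemma harmonic_conv_conv_F:
  assumes f: "canonical_decomp f h g" and z: "z \<in> ball 0 1"
  shows "harmonic_conv conv_F f z = (h z + z * deriv h z) / 2 + cnj ((z * deriv g z - g z) / 2)"
proof -
  let ?A = "\<lambda>n. if n = 0 then 0 else (of_nat n + 1) / 2 :: complex"
  let ?B = "\<lambda>n. if n = 0 then 0 else (of_nat n - 1) / 2 :: complex"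
  let ?a = "\<lambda>n. (deriv ^^ n) h 0 / fact n" and ?b = "\<lambda>n. (deriv ^^ n) g 0 / fact n"
  note F = f[unfolded canonical_decomp_def]
  have h: "(\<lambda>n. ?a n * z ^ n) sums h z" and g: "(\<lambda>n. ?b n * z ^ n) sums g z"
    using F z holomorphic_power_series[of h 0 1 z] holomorphic_power_series[of g 0 1 z] by simp_all
  have h': "(\<lambda>n. of_nat n * ?a n * z ^ n) sums (z * deriv h z)"
    and g': "(\<lambda>n. of_nat n * ?b n * z ^ n) sums (z * deriv g z)"
    using F z euler_operator_power_series by blast+
  have weights: "x * ((m + 1) / 2) * p = (x * p + m * x * p) / 2"
    "x * ((m - 1) / 2) * p = (m * x * p - x * p) / 2" for x m p :: complex
    by (simp_all add: field_simps)
  have "?a n * ?A n * z ^ n = (?a n * z ^ n + of_nat n * ?a n * z ^ n) / 2" for n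
    using F by (cases "n = 0") (simp_all only: weights if_True if_False, simp_all)
  then have "(\<lambda>n. ?a n * ?A n * z ^ n) sums ((h z + z * deriv h z) / 2)"
    using sums_divide[OF sums_add[OF h h'], of 2] by presburger
  moreover have "?b n * ?B n * z ^ n = (of_nat n * ?b n * z ^ n - ?b n * z ^ n) / 2" for n
    using F by (cases "n = 0") (simp_all only: weights if_True if_False, simp_all)
  then have "(\<lambda>n. ?b n * ?B n * z ^ n) sums ((z * deriv g z - g z) / 2)"
    using sums_divide[OF sums_diff[OF g' g], of 2] by presburger
  ultimately show ?thesis
    unfolding harmonic_conv_eq[OF harmonic_series_conv_F canonical_decomp_imp_harmonic_series[OF f]]
    by (simp only: sums_iff)
qed

text \<open>The common factor is \<open>h' / (2 (1 + w) (1 - z))\<close>; the terms \<open>z w w' (1 - z)\<close> in the second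
  formula cancel, which leaves an expression in \<open>w\<close> and \<open>w'\<close> alone.\<close>

lemma shear_conv_derivs:
  assumes hol: "h holomorphic_on ball 0 1" "g holomorphic_on ball 0 1" "w holomorphic_on ball 0 1"
    and sum: "\<And>z. z \<in> ball 0 1 \<Longrightarrow> h z + g z = z / (1 - z)"
    and dil: "\<And>z. z \<in> ball 0 1 \<Longrightarrow> deriv g z = w z * deriv h z"
    and z: "z \<in> ball 0 1"
  shows "\<exists>k. k \<noteq> 0 \<and>
     deriv (\<lambda>z. (h z + z * deriv h z) / 2) z = k * (2 * (1 + w z) - z * deriv w z * (1 - z)) \<and>
     deriv (\<lambda>z. (z * deriv g z - g z) / 2) z =
       k * (z * (deriv w z * (1 - z) + 2 * w z * (1 + w z)))"
proof -
  have hd: "(K has_field_derivative deriv K u) (at u)"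
    if "K holomorphic_on ball 0 1" "u \<in> ball 0 1" for K u
    using that holomorphic_derivI by blast
  note hol' = hol(1,2)[THEN holomorphic_deriv[OF _ open_ball]]
  have h': "deriv h u * (1 + w u) * (1 - u)\<^sup>2 = 1" if u: "u \<in> ball 0 1" for u
  proof -
    have ne: "u \<noteq> 1" using u by auto
    have "((\<lambda>u. u / (1 - u)) has_field_derivative 1 / (1 - u)\<^sup>2) (at u)"
      using ne by (auto intro!: derivative_eq_intros simp: power2_eq_square field_simps)
    moreover have "((\<lambda>u. u / (1 - u)) has_field_derivative deriv h u + deriv g u) (at u)"
      by (rule has_field_derivative_transform_within_open[where f = "\<lambda>u. h u + g u" and S = "ball 0 1"])
         (use hd[OF hol(1) u] hd[OF hol(2) u] u sum in \<open>auto intro!: derivative_intros\<close>)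
    ultimately have "deriv h u + deriv g u = 1 / (1 - u)\<^sup>2"
      using DERIV_unique by blast
    then show ?thesis using dil[OF u] ne by (simp add: field_simps)
  qed
  define a b c d where "a = deriv h z" and "b = deriv (deriv h) z" and "c = w z" and "d = deriv w z"
  note [derivative_intros] = hd[OF hol(1) z] hd[OF hol(2) z] hd[OF hol(3) z]
    hd[OF hol'(1) z] hd[OF hol'(2) z]
  have ne: "a \<noteq> 0" "1 + c \<noteq> 0" "1 - z \<noteq> 0"
    using h'[OF z] by (auto simp: a_def c_def)
  have "((\<lambda>u. deriv h u * (1 + w u) * (1 - u)\<^sup>2) has_field_derivative
      (b * (1 + c) + a * d) * (1 - z)\<^sup>2 - a * (1 + c) * 2 * (1 - z)) (at z)"
    by (auto intro!: derivative_eq_intros simp: a_def b_def c_def d_def algebra_simps)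
  moreover have "((\<lambda>u. deriv h u * (1 + w u) * (1 - u)\<^sup>2) has_field_derivative 0) (at z)"
    by (rule has_field_derivative_transform_within_open[where f = "\<lambda>_. 1" and S = "ball 0 1"]) (use z h' in auto)
  ultimately have "(b * (1 + c) + a * d) * (1 - z)\<^sup>2 - a * (1 + c) * 2 * (1 - z) = 0"
    using DERIV_unique by blast
  then have "(1 - z) * ((b * (1 + c) + a * d) * (1 - z) - a * (1 + c) * 2) = 0"
    by (simp add: power2_eq_square algebra_simps)
  then have "(b * (1 + c) + a * d) * (1 - z) - a * (1 + c) * 2 = 0"
    using ne by simp
  then have h2: "b * ((1 + c) * (1 - z)) = a * (2 * (1 + c) - d * (1 - z))"
    by (simp add: algebra_simps)
  have "((\<lambda>u. w u * deriv h u) has_field_derivative d * a + c * b) (at z)"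
    by (auto intro!: derivative_eq_intros simp: a_def b_def c_def d_def algebra_simps)
  then have "(deriv g has_field_derivative d * a + c * b) (at z)"
    by (rule has_field_derivative_transform_within_open[where S = "ball 0 1"]) (use z dil in auto)
  then have g2: "deriv (deriv g) z = d * a + c * b"
    by (rule DERIV_imp_deriv)
  have H: "deriv (\<lambda>z. (h z + z * deriv h z) / 2) z = (2 * a + z * b) / 2"
    by (rule DERIV_imp_deriv) (auto intro!: derivative_eq_intros simp: a_def b_def)
  have G: "deriv (\<lambda>z. (z * deriv g z - g z) / 2) z = z * (d * a + c * b) / 2"
    by (rule DERIV_imp_deriv) (auto intro!: derivative_eq_intros simp: g2)
  define q where "q = (1 + c) * (1 - z)"
  have q: "q \<noteq> 0" and b: "b * q = a * (2 * (1 + c) - d * (1 - z))"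
    using ne h2 by (auto simp: q_def)
  have common_factor: "x / 2 = a / (2 * q) * y" if "x * q = a * y" for x y
    using q that by (simp add: field_simps)
  have "(2 * a + z * b) * q = 2 * a * q + z * (b * q)"
    by (simp add: algebra_simps)
  also have "\<dots> = a * (2 * (1 + c) - z * d * (1 - z))"
    unfolding b by (simp add: q_def algebra_simps)
  finally have 1: "(2 * a + z * b) / 2 = a / (2 * q) * (2 * (1 + c) - z * d * (1 - z))"
    by (rule common_factor)
  have "z * (d * a + c * b) * q = z * (d * a * q + c * (b * q))"
    by (simp add: algebra_simps)
  also have "\<dots> = a * (z * (d * (1 - z) + 2 * c * (1 + c)))"
    unfolding b by (simp add: q_def algebra_simps)
  finally have 2: "z * (d * a + c * b) / 2 = a / (2 * q) * (z * (d * (1 - z) + 2 * c * (1 + c)))"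
    by (rule common_factor)
  show ?thesis
    unfolding H G using 1 2 ne q by (intro exI[of _ "a / (2 * q)"]) (auto simp: c_def d_def)
qed

text \<open>Here \<open>|2 + c z + c z\<^sup>2|\<^sup>2 - |1 + z + 2 c z\<^sup>2|\<^sup>2 = (1 - |z|\<^sup>2) (3 + 2 Re ((2 c - 1) z) + 3 |z|\<^sup>2)\<close>,
  the Schur--Cohn identity for a polynomial and its reciprocal, and the last factor is at least
  \<open>3 (1 - |z|)\<^sup>2\<close>.\<close>

lemma reciprocal_quadratic_norm_less:
  fixes c z :: complex
  assumes c: "cmod c = 1" and z: "cmod z < 1"
  shows "cmod (1 + z + 2 * c * z\<^sup>2) < cmod (2 + c * z + c * z\<^sup>2)"
proof -
  have cc: "c * cnj c = 1"
    using c complex_norm_square[of c] by simp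
  have id: "complex_of_real ((cmod (2 + c * z + c * z\<^sup>2))\<^sup>2 - (cmod (1 + z + 2 * c * z\<^sup>2))\<^sup>2) =
    of_real ((1 - (cmod z)\<^sup>2) * (3 + 2 * Re ((2 * c - 1) * z) + 3 * (cmod z)\<^sup>2))"
  proof -
    have re: "complex_of_real (2 * Re u) = u + cnj u" for u
      by (simp add: complex_eq_iff)
    have "(2 + c * z + c * z\<^sup>2) * cnj (2 + c * z + c * z\<^sup>2)
        - (1 + z + 2 * c * z\<^sup>2) * cnj (1 + z + 2 * c * z\<^sup>2)
      = (1 - z * cnj z) * (3 + ((2 * c - 1) * z + cnj ((2 * c - 1) * z)) + 3 * (z * cnj z))"
      unfolding complex_cnj_add complex_cnj_mult complex_cnj_power complex_cnj_diff
        complex_cnj_one complex_cnj_numeral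
      using cc by algebra
    then show ?thesis
      unfolding of_real_diff of_real_mult of_real_add complex_norm_square re[symmetric] by simp
  qed
  have "cmod (2 * c - 1) \<le> 3"
    using norm_triangle_ineq4[of "2 * c" 1] c by (simp add: norm_mult)
  then have "cmod ((2 * c - 1) * z) \<le> 3 * cmod z"
    by (simp add: norm_mult mult_right_mono)
  then have "- (3 * cmod z) \<le> Re ((2 * c - 1) * z)"
    using abs_Re_le_cmod[of "(2 * c - 1) * z"] by linarith
  moreover have "3 * (1 - cmod z)\<^sup>2 > 0"
    using z by simp
  ultimately have "3 + 2 * Re ((2 * c - 1) * z) + 3 * (cmod z)\<^sup>2 > 0"
    unfolding power2_diff by simp
  moreover have "1 - (cmod z)\<^sup>2 > 0"
    using z by (simp add: power_less_one_iff)
  ultimately have "(cmod (1 + z + 2 * c * z\<^sup>2))\<^sup>2 < (cmod (2 + c * z + c * z\<^sup>2))\<^sup>2"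
    using id unfolding of_real_eq_iff by (smt (verit) mult_pos_pos)
  then show ?thesis
    using power2_less_imp_less norm_ge_zero by blast
qed

lemma monomial_dilatation_bound:
  fixes c z :: complex
  assumes c: "cmod c = 1" and z: "cmod z < 1" and n: "n = 1 \<or> n = 2"
  defines "w \<equiv> \<lambda>z. c * z ^ n"
  shows "cmod (z * (deriv w z * (1 - z) + 2 * w z * (1 + w z)))
       < cmod (2 * (1 + w z) - z * deriv w z * (1 - z))"
proof -
  have "(w has_field_derivative of_nat n * c * z ^ (n - 1)) (at z)"
    unfolding w_def by (auto intro!: derivative_eq_intros)
  then have w': "deriv w z = of_nat n * c * z ^ (n - 1)"
    by (rule DERIV_imp_deriv)
  show ?thesis using n
  proof
    assume "n = 1"
    then have N: "z * (deriv w z * (1 - z) + 2 * w z * (1 + w z)) = c * z * (1 + z + 2 * c * z\<^sup>2)"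
      and D: "2 * (1 + w z) - z * deriv w z * (1 - z) = 2 + c * z + c * z\<^sup>2"
      unfolding w' by (simp_all add: w_def power2_eq_square algebra_simps)
    have "cmod (c * z * (1 + z + 2 * c * z\<^sup>2)) \<le> cmod (1 + z + 2 * c * z\<^sup>2)"
      using c z by (simp add: norm_mult mult_left_le_one_le)
    also have "\<dots> < cmod (2 + c * z + c * z\<^sup>2)"
      by (rule reciprocal_quadratic_norm_less[OF c z])
    finally show ?thesis unfolding N D .
  next
    assume "n = 2"
    then have N: "z * (deriv w z * (1 - z) + 2 * w z * (1 + w z)) = c * z\<^sup>2 * (2 * (1 + c * z ^ 3))"
      and D: "2 * (1 + w z) - z * deriv w z * (1 - z) = 2 * (1 + c * z ^ 3)"
      unfolding w' by (simp_all add: w_def power2_eq_square power3_eq_cube algebra_simps)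
    have "cmod (c * z ^ 3) < 1"
      using c z by (simp add: norm_mult norm_power power_less_one_iff)
    then have "1 + c * z ^ 3 \<noteq> 0"
      by (metis add_eq_0_iff norm_minus_cancel norm_one order_less_irrefl)
    then have "cmod (2 * (1 + c * z ^ 3)) > 0"
      unfolding norm_mult by simp
    moreover have "cmod (c * z\<^sup>2) < 1"
      using c z by (simp add: norm_mult norm_power power_less_one_iff)
    ultimately show ?thesis
      unfolding N D norm_mult[of "c * z\<^sup>2"] by simp
  qed
qed

theorem theorem3p10:
  fixes f h g :: "complex \<Rightarrow> complex" and \<theta> :: real and n :: nat
  assumes "f \<in> K_H0"
    and "canonical_decomp f h g"
    and "\<And>z. z \<in> ball 0 1 \<Longrightarrow> h z + g z = z / (1 - z)"
    and "\<And>z. z \<in> ball 0 1 \<Longrightarrow> deriv g z / deriv h z = exp (\<i> * of_real \<theta>) * z ^ n"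
    and "n = 1 \<or> n = 2"
  shows "locally_univalent_on (harmonic_conv conv_F f) (ball 0 1)"
proof -
  define c where "c = exp (\<i> * of_real \<theta>)"
  define w where "w = (\<lambda>z. c * z ^ n)"
  have c: "cmod c = 1" by (simp add: c_def)
  have hol: "h holomorphic_on ball 0 1" "g holomorphic_on ball 0 1" and h0: "deriv h 0 = 1"
    using assms(2) by (auto simp: canonical_decomp_def)
  have w: "w holomorphic_on ball 0 1"
    unfolding w_def by (intro holomorphic_intros)
  have dil: "deriv g z = w z * deriv h z" if z: "z \<in> ball 0 1" for z
  proof -
    \<comment> \<open>A zero of \<open>h'\<close> would make the quotient \<open>0\<close>, hence \<open>w z = 0\<close> and \<open>z = 0\<close>; but \<open>h' 0 = 1\<close>.\<close>
    have "deriv h z \<noteq> 0"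
    proof
      assume "deriv h z = 0"
      then have "c * z ^ n = 0"
        using assms(4)[OF z] by (simp add: c_def)
      then show False
        using c h0 \<open>deriv h z = 0\<close> by auto
    qed
    then show ?thesis
      using assms(4)[OF z] by (simp add: w_def c_def field_simps)
  qed
  show ?thesis
  proof (rule harmonic_locally_univalent_on)
    show "(\<lambda>z. (h z + z * deriv h z) / 2) holomorphic_on ball 0 1"
      "(\<lambda>z. (z * deriv g z - g z) / 2) holomorphic_on ball 0 1"
      using hol by (auto intro!: holomorphic_intros)
  next
    fix z :: complex assume z: "z \<in> ball 0 1"
    have "cmod (z * (deriv w z * (1 - z) + 2 * w z * (1 + w z)))
        < cmod (2 * (1 + w z) - z * deriv w z * (1 - z))"
      unfolding w_def by (rule monomial_dilatation_bound) (use c z assms(5) in auto)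
    then show "cmod (deriv (\<lambda>z. (z * deriv g z - g z) / 2) z)
        < cmod (deriv (\<lambda>z. (h z + z * deriv h z) / 2) z)"
      using shear_conv_derivs[OF hol w assms(3) dil z] by (auto simp: norm_mult simp del: mult_eq_0_iff)
    show "harmonic_conv conv_F f z
        = (h z + z * deriv h z) / 2 + cnj ((z * deriv g z - g z) / 2)"
      by (rule harmonic_conv_conv_F[OF assms(2) z])
  qed simp
qed

end
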